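(* Let $\mu,\lambda\in\mathbb{C}^*$, $\alpha\in\mathbb{C}$, and let $V$ be a simple $\mathfrak a$-module in the category $\mathcal C$. Then the $\mathcal L$-module $\mathcal{M}\big(V,\mu,\Omega(\lambda,\alpha)\big)$ is simple if and only if $\alpha\neq 0$ and $\mu\neq 1$.
   Context: $\mathcal L$ is the Virasoro algebra: the complex Lie algebra with basis $\{L_m, C\mid m\in\mathbb{Z}\}$ and brackets $[L_m,L_n]=(n-m)L_{m+n}+\delta_{m+n,0}\frac{m^3-m}{12}C$, $[L_m,C]=0$. $\mathfrak a=\mathrm{span}\{L_i\mid i\ge -1\}$ is a Lie subalgebra of $\mathcal L$. A module $V$ over a Lie algebra $\mathfrak g$ is trivial if $xV=0$ for all $x\in\mathfrak g$, and nontrivial otherwise. $\mathcal C$ is the category of all nontrivial $\mathfrak a$-modules $V$ such that for any $0\ne v\in V$ there exists $r_v\in\mathbb{Z}_+$ with $L_{r_v+i}v=0$ for all $i\ge 1$. Here $\mathbb{Z}_+$ is the set of nonnegative integers and $\mathbb{C}^*=\mathbb{C}\setminus\{0\}$. For $\mu,\lambda\in\mathbb{C}^*$, $\alpha\in\mathbb{C}$ and $V\in\mathcal C$, $\mathcal{M}\big(V,\mu,\Omega(\lambda,\alpha)\big)$ is the $\mathcal L$-module with underlying space $V\otimes\mathbb{C}[\partial]$ and action $$L_m\big(v\otimes f(\partial)\big)=v\otimes\lambda^m(\partial-m\alpha)f(\partial-m)+\Big(\mu^m\sum_{i\ge 0}\frac{m^i}{i!}L_{i-1}v-L_{-1}v\Big)\otimes\lambda^mf(\partial-m),\qquad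 C\big(v\otimes f(\partial)\big)=0$$ for $m\in\mathbb{Z}$, $v\in V$, $f(\partial)\in\mathbb{C}[\partial]$. *)

theory Defs
  imports
    Complex_Main
    "HOL-Library.Poly_Mapping"
    "HOL-Computational_Algebra.Polynomial"
begin

section \<open>Lie algebras and modules over Lie subalgebras\<close>

locale lie_algebra = vector_space scale
  for scale :: "'k::field \<Rightarrow> 'g::ab_group_add \<Rightarrow> 'g" +
  fixes bracket :: "'g \<Rightarrow> 'g \<Rightarrow> 'g"
  assumes bracket_add_left: "bracket (x + y) z = bracket x z + bracket y z"
    and bracket_add_right: "bracket x (y + z) = bracket x y + bracket x z"
    and bracket_scale_left: "bracket (scale c x) y = scale c (bracket x y)"
    and bracket_scale_right: "bracket x (scale c y) = scale c (bracket x y)"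
    and bracket_self: "bracket x x = 0"
    and jacobi: "bracket x (bracket y z) + bracket y (bracket z x) + bracket z (bracket x y) = 0"
begin

definition lie_subalgebra :: "'g set \<Rightarrow> bool" where
  "lie_subalgebra h \<longleftrightarrow> subspace h \<and> (\<forall>x\<in>h. \<forall>y\<in>h. bracket x y \<in> h)"

end

text \<open>A module over the Lie subalgebra \<open>h\<close> of an ambient Lie algebra; the values of \<open>act\<close>
  outside \<open>h\<close> are irrelevant. A module over the whole algebra is the case \<open>h = UNIV\<close>.\<close>

locale lie_module = lie_algebra scale bracket + V: vector_space scaleV
  for scale :: "'k::field \<Rightarrow> 'g::ab_group_add \<Rightarrow> 'g"
    and bracket :: "'g \<Rightarrow> 'g \<Rightarrow> 'g"
    and h :: "'g set"
    and scaleV :: "'k \<Rightarrow> 'v::ab_group_add \<Rightarrow> 'v" +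
  fixes act :: "'g \<Rightarrow> 'v \<Rightarrow> 'v"
  assumes subalgebra: "lie_subalgebra h"
    and act_add_left: "x \<in> h \<Longrightarrow> y \<in> h \<Longrightarrow> act (x + y) v = act x v + act y v"
    and act_scale_left: "x \<in> h \<Longrightarrow> act (scale c x) v = scaleV c (act x v)"
    and act_add_right: "x \<in> h \<Longrightarrow> act x (v + w) = act x v + act x w"
    and act_scale_right: "x \<in> h \<Longrightarrow> act x (scaleV c v) = scaleV c (act x v)"
    and act_bracket: "x \<in> h \<Longrightarrow> y \<in> h \<Longrightarrow> act (bracket x y) v = act x (act y v) - act y (act x v)"

definition trivial_module :: "'g set \<Rightarrow> ('g \<Rightarrow> 'v::zero \<Rightarrow> 'v) \<Rightarrow> bool" where
  "trivial_module h act \<longleftrightarrow> (\<forall>x\<in>h. \<forall>v. act x v = 0)"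

definition submodule ::
    "'g set \<Rightarrow> ('k::field \<Rightarrow> 'v::ab_group_add \<Rightarrow> 'v) \<Rightarrow> ('g \<Rightarrow> 'v \<Rightarrow> 'v) \<Rightarrow> 'v set \<Rightarrow> bool" where
  "submodule h scaleV act W \<longleftrightarrow>
     module.subspace scaleV W \<and> (\<forall>x\<in>h. \<forall>w\<in>W. act x w \<in> W)"

definition simple_module ::
    "'g set \<Rightarrow> ('k::field \<Rightarrow> 'v::ab_group_add \<Rightarrow> 'v) \<Rightarrow> ('g \<Rightarrow> 'v \<Rightarrow> 'v) \<Rightarrow> bool" where
  "simple_module h scaleV act \<longleftrightarrow>
     (UNIV :: 'v set) \<noteq> {0} \<and> (\<forall>W. submodule h scaleV act W \<longrightarrow> W = {0} \<or> W = UNIV)"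


section \<open>The Virasoro algebra\<close>

datatype vir_index = Idx_L int | Idx_C

type_synonym vir = "vir_index \<Rightarrow>\<^sub>0 complex"

definition vir_scale :: "complex \<Rightarrow> vir \<Rightarrow> vir" where
  "vir_scale c x = Poly_Mapping.map ((*) c) x"

definition vir_L :: "int \<Rightarrow> vir" where "vir_L m = Poly_Mapping.single (Idx_L m) 1"

definition vir_C :: vir where "vir_C = Poly_Mapping.single Idx_C 1"

text \<open>The linear extension, to \<^typ>\<open>vir\<close>, of a map given on the basis.\<close>

definition vir_extend ::
    "(complex \<Rightarrow> 'w \<Rightarrow> 'w) \<Rightarrow> (vir_index \<Rightarrow> 'w) \<Rightarrow> vir \<Rightarrow> 'w::ab_group_add" where
  "vir_extend scaleW f x = (\<Sum>b\<in>Poly_Mapping.keys x. scaleW (Poly_Mapping.lookup x b) (f b))"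

fun vir_basis_bracket :: "vir_index \<Rightarrow> vir_index \<Rightarrow> vir" where
  "vir_basis_bracket (Idx_L m) (Idx_L n) =
     vir_scale (of_int (n - m)) (vir_L (m + n)) +
     (if m + n = 0 then vir_scale (of_int (m ^ 3 - m) / 12) vir_C else 0)"
| "vir_basis_bracket _ _ = 0"

definition vir_bracket :: "vir \<Rightarrow> vir \<Rightarrow> vir" where
  "vir_bracket x y =
     vir_extend vir_scale (\<lambda>b. vir_extend vir_scale (\<lambda>c. vir_basis_bracket b c) y) x"

definition vir_a :: "vir set" where
  "vir_a = module.span vir_scale {vir_L i | i. i \<ge> -1}"


section \<open>The category of modules over the subalgebra \<open>vir_a\<close>\<close>

definition in_category_C ::
    "(complex \<Rightarrow> 'v::ab_group_add \<Rightarrow> 'v) \<Rightarrow> (vir \<Rightarrow> 'v \<Rightarrow> 'v) \<Rightarrow> bool" where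
  "in_category_C scaleV act \<longleftrightarrow>
     lie_module vir_scale vir_bracket vir_a scaleV act \<and>
     \<not> trivial_module vir_a act \<and>
     (\<forall>v. v \<noteq> 0 \<longrightarrow> (\<exists>r::nat. \<forall>i::nat. i \<ge> 1 \<longrightarrow> act (vir_L (int r + int i)) v = 0))"


section \<open>The tensor product of a space with a polynomial ring\<close>

text \<open>The tensor product of a complex vector space of type \<open>'v\<close> with the polynomial ring
  \<^typ>\<open>complex poly\<close> is realised as \<open>'v poly\<close>, the polynomials with coefficients in \<open>'v\<close>, a
  pure tensor being the polynomial whose coefficients are the multiples of the vector by those
  of the polynomial. The universal property is proved in \<open>tensor_universal\<close> below.\<close>

definition tensor_scale ::
    "(complex \<Rightarrow> 'v::ab_group_add \<Rightarrow> 'v) \<Rightarrow> complex \<Rightarrow> 'v poly \<Rightarrow> 'v poly" where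
  "tensor_scale scaleV c p = map_poly (scaleV c) p"

definition tensor ::
    "(complex \<Rightarrow> 'v::ab_group_add \<Rightarrow> 'v) \<Rightarrow> 'v \<Rightarrow> complex poly \<Rightarrow> 'v poly" where
  "tensor scaleV v f = map_poly (\<lambda>c. scaleV c v) f"

text \<open>The linear map on the tensor product induced by a bilinear map.\<close>

definition tensor_lift ::
    "('v::ab_group_add \<Rightarrow> complex poly \<Rightarrow> 'w::ab_group_add) \<Rightarrow> 'v poly \<Rightarrow> 'w" where
  "tensor_lift B p = (\<Sum>k\<le>degree p. B (coeff p k) (monom 1 k))"


section \<open>The Virasoro modules\<close>

text \<open>The sum over \<open>i\<close> has only finitely many nonzero terms when the module is in the category,
  and \<^const>\<open>Sum_any\<close> sums exactly these.\<close>

definition M_gen ::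
    "(complex \<Rightarrow> 'v::ab_group_add \<Rightarrow> 'v) \<Rightarrow> (vir \<Rightarrow> 'v \<Rightarrow> 'v) \<Rightarrow> complex \<Rightarrow> complex \<Rightarrow> complex \<Rightarrow>
     int \<Rightarrow> 'v \<Rightarrow> complex poly \<Rightarrow> 'v poly" where
  "M_gen scaleV act \<mu> lam \<alpha> m v f =
     (let shifted = pcompose f [:- of_int m, 1:] in
      tensor scaleV v (smult (lam powi m) ([:- of_int m * \<alpha>, 1:] * shifted)) +
      tensor scaleV
        (scaleV (\<mu> powi m)
           (Sum_any (\<lambda>i::nat. scaleV (of_int m ^ i / fact i) (act (vir_L (int i - 1)) v)))
         - act (vir_L (-1)) v)
        (smult (lam powi m) shifted))"

fun M_basis_act ::
    "(complex \<Rightarrow> 'v::ab_group_add \<Rightarrow> 'v) \<Rightarrow> (vir \<Rightarrow> 'v \<Rightarrow> 'v) \<Rightarrow> complex \<Rightarrow> complex \<Rightarrow> complex \<Rightarrow>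
     vir_index \<Rightarrow> 'v poly \<Rightarrow> 'v poly" where
  "M_basis_act scaleV act \<mu> lam \<alpha> (Idx_L m) p = tensor_lift (M_gen scaleV act \<mu> lam \<alpha> m) p"
| "M_basis_act scaleV act \<mu> lam \<alpha> Idx_C p = 0"

definition M_act ::
    "(complex \<Rightarrow> 'v::ab_group_add \<Rightarrow> 'v) \<Rightarrow> (vir \<Rightarrow> 'v \<Rightarrow> 'v) \<Rightarrow> complex \<Rightarrow> complex \<Rightarrow> complex \<Rightarrow>
     vir \<Rightarrow> 'v poly \<Rightarrow> 'v poly" where
  "M_act scaleV act \<mu> lam \<alpha> x p =
     vir_extend (tensor_scale scaleV) (\<lambda>b. M_basis_act scaleV act \<mu> lam \<alpha> b p) x"

section \<open>Consistency of the definitions\<close>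

lemma lookup_vir_scale [simp]:
  "Poly_Mapping.lookup (vir_scale c x) b = c * Poly_Mapping.lookup x b"
  by (simp add: vir_scale_def map.rep_eq when_def)

interpretation VS: vector_space vir_scale
  by unfold_locales (auto intro!: poly_mapping_eqI simp: lookup_add algebra_simps)

lemma vir_basis_induct [case_names zero basis add]:
  assumes "P 0" and "\<And>c b. P (vir_scale c (Poly_Mapping.single b 1))"
    and "\<And>x y. P x \<Longrightarrow> P y \<Longrightarrow> P (x + y)"
  shows "P (x :: vir)"
proof -
  have P_sum: "P (\<Sum>b\<in>A. vir_scale (Poly_Mapping.lookup x b) (Poly_Mapping.single b 1))"
    if "finite A" for A
    using that by (induction A) (auto intro: assms)
  have "x = (\<Sum>b\<in>Poly_Mapping.keys x. vir_scale (Poly_Mapping.lookup x b) (Poly_Mapping.single b 1))"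
  proof (rule poly_mapping_eqI)
    fix c
    have "(\<Sum>b\<in>Poly_Mapping.keys x. Poly_Mapping.lookup x b * (1 when b = c)) = 
          (\<Sum>b\<in>Poly_Mapping.keys x. if b = c then Poly_Mapping.lookup x b else 0)"
      by (intro sum.cong) (auto simp: when_def)
    then show "Poly_Mapping.lookup x c = Poly_Mapping.lookup
        (\<Sum>b\<in>Poly_Mapping.keys x. vir_scale (Poly_Mapping.lookup x b) (Poly_Mapping.single b 1)) c"
      by (simp add: lookup_sum lookup_single in_keys_iff)
  qed
  then show ?thesis using P_sum[of "Poly_Mapping.keys x"] by simp
qed

locale complex_space = W: vector_space scaleW
  for scaleW :: "complex \<Rightarrow> 'w::ab_group_add \<Rightarrow> 'w"
begin

lemma vir_extend_superset:
  assumes "finite A" "Poly_Mapping.keys x \<subseteq> A"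
  shows "vir_extend scaleW f x = (\<Sum>b\<in>A. scaleW (Poly_Mapping.lookup x b) (f b))"
  unfolding vir_extend_def
  by (rule sum.mono_neutral_left) (use assms in \<open>auto simp: in_keys_iff\<close>)

lemma vir_extend_add: "vir_extend scaleW f (x + y) = vir_extend scaleW f x + vir_extend scaleW f y"
proof -
  let ?A = "Poly_Mapping.keys x \<union> Poly_Mapping.keys y"
  have "Poly_Mapping.keys (x + y) \<subseteq> ?A" by (rule Poly_Mapping.keys_add)
  then show ?thesis
    by (simp add: vir_extend_superset[of ?A] lookup_add W.scale_left_distrib sum.distrib)
qed

lemma vir_extend_scale: "vir_extend scaleW f (vir_scale c x) = scaleW c (vir_extend scaleW f x)"
proof -
  have "Poly_Mapping.keys (vir_scale c x) \<subseteq> Poly_Mapping.keys x" by (auto simp: in_keys_iff)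
  then show ?thesis
    by (simp add: vir_extend_superset[of "Poly_Mapping.keys x"] W.scale_sum_right)
qed

lemma vir_extend_basis [simp]: "vir_extend scaleW f (Poly_Mapping.single b 1) = f b"
  by (simp add: vir_extend_def)

lemma vir_extend_zero [simp]: "vir_extend scaleW f 0 = 0"
  by (simp add: vir_extend_def)

lemma vir_extend_fun_add:
  "vir_extend scaleW (\<lambda>b. f b + g b) x = vir_extend scaleW f x + vir_extend scaleW g x"
  by (simp add: vir_extend_def W.scale_right_distrib sum.distrib)

lemma vir_extend_fun_scale:
  "vir_extend scaleW (\<lambda>b. scaleW c (f b)) x = scaleW c (vir_extend scaleW f x)"
  by (simp add: vir_extend_def W.scale_sum_right mult.commute)

end

interpretation VE: complex_space vir_scale ..

lemma vir_bracket_add_left: "vir_bracket (x + y) z = vir_bracket x z + vir_bracket y z"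
  and vir_bracket_add_right: "vir_bracket x (y + z) = vir_bracket x y + vir_bracket x z"
  and vir_bracket_scale_left: "vir_bracket (vir_scale c x) y = vir_scale c (vir_bracket x y)"
  and vir_bracket_scale_right: "vir_bracket x (vir_scale c y) = vir_scale c (vir_bracket x y)"
  by (simp_all add: vir_bracket_def VE.vir_extend_add VE.vir_extend_scale
        VE.vir_extend_fun_add VE.vir_extend_fun_scale)

lemma vir_bracket_basis [simp]:
  "vir_bracket (Poly_Mapping.single b 1) (Poly_Mapping.single c 1) = vir_basis_bracket b c"
  by (simp add: vir_bracket_def)

lemma vir_bracket_zero [simp]: "vir_bracket 0 x = 0" "vir_bracket x 0 = 0"
  by (simp_all add: vir_bracket_def vir_extend_def)

theorem vir_bracket_L_L:
  "vir_bracket (vir_L m) (vir_L n) =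
     vir_scale (of_int (n - m)) (vir_L (m + n)) +
     (if m + n = 0 then vir_scale (of_int (m ^ 3 - m) / 12) vir_C else 0)"
  by (simp add: vir_L_def)

theorem vir_bracket_C [simp]: "vir_bracket x vir_C = 0" "vir_bracket vir_C x = 0"
proof -
  show "vir_bracket x vir_C = 0"
    by (induction x rule: vir_basis_induct)
      (auto simp: vir_C_def vir_bracket_add_left vir_bracket_scale_left)
  show "vir_bracket vir_C x = 0"
    by (induction x rule: vir_basis_induct)
      (auto simp: vir_C_def vir_bracket_add_right vir_bracket_scale_right)
qed

lemma vir_basis_bracket_skew: "vir_basis_bracket b c = - vir_basis_bracket c b"
proof (cases b; cases c)
  fix m n assume *: "b = Idx_L m" "c = Idx_L n"
  show ?thesis
  proof (cases "m + n = 0")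
    case True
    then have "n = - m" by simp
    then show ?thesis
      by (intro poly_mapping_eqI) (simp add: * lookup_add lookup_minus field_simps)
  qed (intro poly_mapping_eqI, auto simp: * lookup_add add.commute algebra_simps)
qed auto

lemma vir_bracket_skew: "vir_bracket x y = - vir_bracket y x"
proof (induction x rule: vir_basis_induct)
  case (basis c b)
  show ?case
  proof (induction y rule: vir_basis_induct)
    case (basis d e)
    show ?case
      using vir_basis_bracket_skew[of b e]
      by (simp add: vir_bracket_scale_left vir_bracket_scale_right mult.commute)
  qed (auto simp: vir_bracket_add_left vir_bracket_add_right)
qed (auto simp: vir_bracket_add_left vir_bracket_add_right)

lemma vir_jacobi_L:
  "vir_bracket (vir_L l) (vir_bracket (vir_L m) (vir_L n)) +
   vir_bracket (vir_L m) (vir_bracket (vir_L n) (vir_L l)) +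
   vir_bracket (vir_L n) (vir_bracket (vir_L l) (vir_L m)) = 0"
proof -
  have eq: "vir_bracket (vir_L i) (vir_bracket (vir_L j) (vir_L k)) =
      vir_scale (of_int ((k - j) * (j + k - i))) (vir_L (l + m + n)) +
      (if l + m + n = 0 then vir_scale (of_int ((k - j) * (i ^ 3 - i)) / 12) vir_C else 0)"
    if "i + j + k = l + m + n" for i j k
  proof -
    have "i + (j + k) = l + m + n" using that by simp
    then show ?thesis
      by (simp add: vir_bracket_L_L vir_bracket_add_right vir_bracket_scale_right
          VS.scale_right_distrib)
  qed
  have e1: "(n - m) * (m + n - l) + (l - n) * (n + l - m) + (m - l) * (l + m - n) = 0"
    by (simp add: algebra_simps)
  have e2: "(n - m) * (l ^ 3 - l) + (l - n) * (m ^ 3 - m) + (m - l) * (n ^ 3 - n) = 0"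
    if "l + m + n = 0"
  proof -
    from that have "n = - l - m" by simp
    show ?thesis unfolding \<open>n = - l - m\<close> by (simp add: algebra_simps power3_eq_cube)
  qed
  have e1': "vir_scale (of_int ((n - m) * (m + n - l))) x + vir_scale (of_int ((l - n) * (n + l - m))) x
       + vir_scale (of_int ((m - l) * (l + m - n))) x = 0" for x
    by (simp only: VS.scale_left_distrib[symmetric] of_int_add[symmetric] e1) simp
  have e2': "vir_scale (of_int ((n - m) * (l ^ 3 - l)) / 12) x
       + vir_scale (of_int ((l - n) * (m ^ 3 - m)) / 12) x
       + vir_scale (of_int ((m - l) * (n ^ 3 - n)) / 12) x = 0" if "l + m + n = 0" for x
    by (simp only: VS.scale_left_distrib[symmetric] add_divide_distrib[symmetric]
          of_int_add[symmetric] e2[OF that]) simp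
  have abs: "(a1 + (if P then c1 else 0)) + (a2 + (if P then c2 else 0)) + (a3 + (if P then c3 else 0)) = 0"
    if "a1 + a2 + a3 = 0" "P \<Longrightarrow> c1 + c2 + c3 = 0" for a1 a2 a3 c1 c2 c3 :: vir and P
  proof -
    have "(a1 + c1) + (a2 + c2) + (a3 + c3) = (a1 + a2 + a3) + (c1 + c2 + c3)"
      by (simp add: add_ac)
    then show ?thesis using that by (cases P) simp_all
  qed
  have perm: "m + n + l = l + m + n" "n + l + m = l + m + n" by simp_all
  show ?thesis
    unfolding eq[OF refl] eq[OF perm(1)] eq[OF perm(2)]
    by (rule abs) (fact e1', fact e2')
qed

lemma vir_basis_cases: "(\<exists>m. Poly_Mapping.single b 1 = vir_L m) \<or> Poly_Mapping.single b 1 = vir_C"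
  by (cases b) (auto simp: vir_L_def vir_C_def)

theorem virasoro_lie_algebra: "lie_algebra vir_scale vir_bracket"
proof
  fix x y z :: vir and c :: complex
  show "vir_bracket x x = 0"
  proof -
    have "vir_bracket x x + vir_bracket x x = 0"
      using vir_bracket_skew[of x x] by (metis add.right_inverse)
    then have "vir_scale 2 (vir_bracket x x) = 0"
      by (metis VS.scale_left_distrib VS.scale_one one_add_one)
    then show ?thesis by simp
  qed
  show "vir_bracket x (vir_bracket y z) + vir_bracket y (vir_bracket z x) +
        vir_bracket z (vir_bracket x y) = 0" (is "?J x y z = 0")
  proof -
    have J_add: "?J (x + x') y z = ?J x y z + ?J x' y z" "?J x (y + y') z = ?J x y z + ?J x y' z"
      "?J x y (z + z') = ?J x y z + ?J x y z'" for x x' y y' z z'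
      by (simp_all add: vir_bracket_add_left vir_bracket_add_right)
    have J_scale: "?J (vir_scale c x) y z = vir_scale c (?J x y z)"
      "?J x (vir_scale c y) z = vir_scale c (?J x y z)"
      "?J x y (vir_scale c z) = vir_scale c (?J x y z)" for c x y z
      by (simp_all add: vir_bracket_scale_left vir_bracket_scale_right VS.scale_right_distrib)
    have J_basis: "?J (Poly_Mapping.single b 1) (Poly_Mapping.single c 1) (Poly_Mapping.single d 1) = 0" for b c d
      using vir_basis_cases[of b] vir_basis_cases[of c] vir_basis_cases[of d]
      by (elim disjE exE) (simp_all only: vir_bracket_C vir_bracket_zero vir_jacobi_L add_0)
    have 1: "?J (Poly_Mapping.single b 1) (Poly_Mapping.single c 1) z = 0" for b c
    proof (induction z rule: vir_basis_induct)
      case (basis a d)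
      show ?case by (simp only: J_scale J_basis VS.scale_zero_right)
    qed (simp_all only: J_add add_0 vir_bracket_zero)
    have 2: "?J (Poly_Mapping.single b 1) y z = 0" for b
    proof (induction y rule: vir_basis_induct)
      case (basis a d)
      show ?case by (simp only: J_scale 1 VS.scale_zero_right)
    qed (simp_all only: J_add add_0 vir_bracket_zero)
    show ?thesis
    proof (induction x rule: vir_basis_induct)
      case (basis a d)
      show ?case by (simp only: J_scale 2 VS.scale_zero_right)
    qed (simp_all only: J_add add_0 vir_bracket_zero)
  qed
qed (fact vir_bracket_add_left vir_bracket_add_right vir_bracket_scale_left vir_bracket_scale_right)+

interpretation Vir: lie_algebra vir_scale vir_bracket
  by (rule virasoro_lie_algebra)

lemma vir_bracket_a:
  assumes "i \<ge> -1" "j \<ge> -1"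
  shows "vir_bracket (vir_L i) (vir_L j) = vir_scale (of_int (j - i)) (vir_L (i + j))"
proof -
  have "of_int (i ^ 3 - i) / 12 = (0 :: complex)" if "i + j = 0"
  proof -
    have "i = -1 \<or> i = 0 \<or> i = 1" using that assms by auto
    then show ?thesis by auto
  qed
  then show ?thesis
    by (simp add: vir_bracket_L_L del: of_int_diff)
qed

theorem vir_a_subalgebra: "Vir.lie_subalgebra vir_a"
  unfolding Vir.lie_subalgebra_def
proof (intro conjI ballI)
  show "VS.subspace vir_a" by (simp add: vir_a_def VS.subspace_span)
  let ?B = "{vir_L i | i. i \<ge> -1}"
  have gen: "vir_bracket (vir_L i) (vir_L j) \<in> vir_a" if "i \<ge> -1" "j \<ge> -1" for i j
  proof (cases "i + j \<ge> -1")
    case True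
    then have "vir_L (i + j) \<in> vir_a" unfolding vir_a_def by (intro VS.span_base) auto
    then show ?thesis
      by (simp add: vir_bracket_a[OF that] vir_a_def VS.span_scale del: of_int_diff)
  next
    case False
    then have "i = -1" "j = -1" using that by auto
    then show ?thesis by (simp add: Vir.bracket_self vir_a_def VS.span_zero)
  qed
  have gen': "vir_bracket (vir_L i) y \<in> vir_a" if "i \<ge> -1" "y \<in> vir_a" for i y
    using that(2) unfolding vir_a_def
  proof (induction rule: VS.span_induct_alt)
    case (step c x y)
    then show ?case using gen[OF that(1)]
      by (auto simp: vir_bracket_add_right vir_bracket_scale_right vir_a_def
          intro!: VS.span_add VS.span_scale)
  qed (simp add: VS.span_zero)
  fix x y assume "x \<in> vir_a" "y \<in> vir_a"
  from this(1) show "vir_bracket x y \<in> vir_a" unfolding vir_a_def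
  proof (induction rule: VS.span_induct_alt)
    case (step c z w)
    then show ?case using gen'[OF _ \<open>y \<in> vir_a\<close>]
      by (auto simp: vir_bracket_add_left vir_bracket_scale_left vir_a_def
          intro!: VS.span_add VS.span_scale)
  qed (simp add: VS.span_zero)
qed

context complex_space
begin

lemma coeff_tensor [simp]: "coeff (tensor scaleW v f) n = scaleW (coeff f n) v"
  by (simp add: tensor_def coeff_map_poly)

lemma coeff_tensor_scale [simp]: "coeff (tensor_scale scaleW c p) n = scaleW c (coeff p n)"
  by (simp add: tensor_scale_def coeff_map_poly)

lemma tensor_vector_space: "vector_space (tensor_scale scaleW)"
  by unfold_locales (auto intro!: poly_eqI simp: W.scale_right_distrib W.scale_left_distrib)

lemma tensor_add_left: "tensor scaleW (v + w) f = tensor scaleW v f + tensor scaleW w f"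
  and tensor_add_right: "tensor scaleW v (f + g) = tensor scaleW v f + tensor scaleW v g"
  and tensor_scale_left: "tensor scaleW (scaleW c v) f = tensor_scale scaleW c (tensor scaleW v f)"
  and tensor_scale_right: "tensor scaleW v (smult c f) = tensor_scale scaleW c (tensor scaleW v f)"
  by (auto intro!: poly_eqI simp: W.scale_right_distrib W.scale_left_distrib mult.commute)

lemma tensor_zero [simp]: "tensor scaleW 0 f = 0" "tensor scaleW v 0 = 0"
  by (auto intro!: poly_eqI)

lemma tensor_decomp: "p = (\<Sum>k\<le>degree p. tensor scaleW (coeff p k) (monom 1 k))"
proof -
  have "tensor scaleW v (monom 1 k) = monom v k" for v k
    by (auto intro!: poly_eqI)
  then show ?thesis by (simp add: poly_as_sum_of_monoms)
qed

lemma tensor_induct [case_names tensor add]: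
  assumes "\<And>v f. P (tensor scaleW v f)" "\<And>p q. P p \<Longrightarrow> P q \<Longrightarrow> P (p + q)"
  shows "P p"
proof -
  have "P (\<Sum>k\<in>A. tensor scaleW (coeff p k) (monom 1 k))" if "finite A" for A
    using that
  proof (induction A)
    case empty
    show ?case using assms(1)[of 0 0] by simp
  qed (simp add: assms)
  then show ?thesis using tensor_decomp[of p] by (metis finite_atMost)
qed

end

locale tensor_bilinear = complex_space scaleW + U: vector_space scaleU
  for scaleW :: "complex \<Rightarrow> 'w::ab_group_add \<Rightarrow> 'w"
    and scaleU :: "complex \<Rightarrow> 'u::ab_group_add \<Rightarrow> 'u" +
  fixes B :: "'w \<Rightarrow> complex poly \<Rightarrow> 'u"
  assumes B_add_left: "B (v + w) f = B v f + B w f"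
    and B_add_right: "B v (f + g) = B v f + B v g"
    and B_scale_left: "B (scaleW c v) f = scaleU c (B v f)"
    and B_scale_right: "B v (smult c f) = scaleU c (B v f)"
begin

lemma B_zero [simp]: "B 0 f = 0" "B v 0 = 0"
  using B_scale_left[of 0 0 f] B_scale_right[of v 0 0] by simp_all

lemma tensor_lift_superset:
  "degree p \<le> N \<Longrightarrow> tensor_lift B p = (\<Sum>k\<le>N. B (coeff p k) (monom 1 k))"
  unfolding tensor_lift_def by (rule sum.mono_neutral_left) (auto simp: coeff_eq_0)

lemma tensor_lift_add: "tensor_lift B (p + q) = tensor_lift B p + tensor_lift B q"
proof -
  let ?N = "max (degree p) (degree q)"
  have "degree (p + q) \<le> ?N" by (rule degree_add_le_max)
  then show ?thesis
    by (simp add: tensor_lift_superset[of _ ?N] B_add_left sum.distrib)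
qed

lemma tensor_lift_scale: "tensor_lift B (tensor_scale scaleW c p) = scaleU c (tensor_lift B p)"
proof -
  have "degree (tensor_scale scaleW c p) \<le> degree p"
    by (rule degree_le) (simp add: coeff_eq_0)
  then show ?thesis
    by (simp add: tensor_lift_superset[of _ "degree p"] B_scale_left U.scale_sum_right)
qed

lemma B_sum_right: "B v (\<Sum>k\<in>A. f k) = (\<Sum>k\<in>A. B v (f k))"
  by (induction A rule: infinite_finite_induct) (simp_all add: B_add_right)

lemma tensor_lift_tensor: "tensor_lift B (tensor scaleW v f) = B v f"
proof -
  have "degree (tensor scaleW v f) \<le> degree f"
    by (rule degree_le) (simp add: coeff_eq_0)
  then have "tensor_lift B (tensor scaleW v f) = (\<Sum>k\<le>degree f. B v (smult (coeff f k) (monom 1 k)))"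
    by (simp add: tensor_lift_superset[of _ "degree f"] B_scale_left B_scale_right del: smult_monom)
  also have "\<dots> = B v f"
    by (simp add: B_sum_right[symmetric] smult_monom poly_as_sum_of_monoms)
  finally show ?thesis .
qed

theorem tensor_universal:
  "Vector_Spaces.linear (tensor_scale scaleW) scaleU (tensor_lift B)"
  "tensor_lift B (tensor scaleW v f) = B v f"
  "Vector_Spaces.linear (tensor_scale scaleW) scaleU h \<Longrightarrow> (\<And>v f. h (tensor scaleW v f) = B v f) \<Longrightarrow> h = tensor_lift B"
proof -
  show "Vector_Spaces.linear (tensor_scale scaleW) scaleU (tensor_lift B)"
    by (simp add: linear_iff_module_hom module_hom_iff module_iff_vector_space tensor_vector_space
        U.vector_space_axioms tensor_lift_add tensor_lift_scale)
  show "tensor_lift B (tensor scaleW v f) = B v f" by (rule tensor_lift_tensor)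
  assume h: "Vector_Spaces.linear (tensor_scale scaleW) scaleU h" "\<And>v f. h (tensor scaleW v f) = B v f"
  show "h = tensor_lift B"
  proof
    fix p
    show "h p = tensor_lift B p"
    proof (induction p rule: tensor_induct)
      case (add p q)
      then show ?case using h(1)
        by (simp add: linear_iff_module_hom module_hom_iff tensor_lift_add)
    qed (simp add: h(2) tensor_lift_tensor)
  qed
qed

end


text \<open>For a module in the category, \<open>M_act\<close> is given on pure tensors by the defining formula
  (\<open>M_act_L\<close>, \<open>M_act_C\<close>) and makes the tensor product a module over the whole Virasoro algebra
  (\<open>M_lie_module\<close>).\<close>

locale category_C_module =
  fixes scaleV :: "complex \<Rightarrow> 'v::ab_group_add \<Rightarrow> 'v"
    and act :: "vir \<Rightarrow> 'v \<Rightarrow> 'v"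
  assumes in_category: "in_category_C scaleV act"
begin

sublocale lie_module vir_scale vir_bracket vir_a scaleV act
  using in_category by (simp add: in_category_C_def)

sublocale complex_space scaleV ..

definition a :: "nat \<Rightarrow> 'v \<Rightarrow> 'v" where "a i = act (vir_L (int i - 1))"

lemma L_in_a: "i \<ge> -1 \<Longrightarrow> vir_L i \<in> vir_a"
  unfolding vir_a_def by (rule VS.span_base) auto

lemma a_add: "a i (v + w) = a i v + a i w" and a_scale: "a i (scaleV c v) = scaleV c (a i v)"
  by (simp_all add: a_def L_in_a act_add_right act_scale_right)

lemma a_zero [simp]: "a i 0 = 0"
  using a_scale[of i 0 0] by simp

lemma a_diff: "a i (v - w) = a i v - a i w"
  using a_add[of i "v - w" w] by simp

lemma a_sum: "a i (\<Sum>k\<in>A. f k) = (\<Sum>k\<in>A. a i (f k))"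
  by (induction A rule: infinite_finite_induct) (simp_all add: a_add)

lemma a_bound: "\<exists>r. \<forall>i>r. a i v = 0"
proof (cases "v = 0")
  case False
  then obtain r :: nat where r: "\<And>i::nat. i \<ge> 1 \<Longrightarrow> act (vir_L (int r + int i)) v = 0"
    using in_category unfolding in_category_C_def by blast
  have "a i v = 0" if "i > Suc r" for i
    using r[of "i - 1 - r"] that by (simp add: a_def of_nat_diff)
  then show ?thesis by blast
qed simp

lemma a_comm:
  "a i (a j v) - a j (a i v) = scaleV (of_nat j - of_nat i) (a (i + j - 1) v)"
proof (cases "i + j = 0")
  case False
  have idx: "int i - 1 + (int j - 1) = int (i + j - 1) - 1" using False by linarith
  have coef: "of_int ((int j - 1) - (int i - 1)) = (of_nat j - of_nat i :: complex)" by simp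
  have "vir_bracket (vir_L (int i - 1)) (vir_L (int j - 1)) =
      vir_scale (of_nat j - of_nat i) (vir_L (int (i + j - 1) - 1))"
    using vir_bracket_a[of "int i - 1" "int j - 1"] unfolding idx coef by simp
  then have "act (vir_scale (of_nat j - of_nat i) (vir_L (int (i + j - 1) - 1))) v =
      a i (a j v) - a j (a i v)"
    using act_bracket[of "vir_L (int i - 1)" "vir_L (int j - 1)" v] by (simp add: a_def L_in_a)
  then show ?thesis
    unfolding a_def by (subst (asm) act_scale_left) (simp_all add: L_in_a)
qed simp

definition S :: "int \<Rightarrow> 'v \<Rightarrow> 'v" where
  "S m v = Sum_any (\<lambda>i. scaleV (of_int m ^ i / fact i) (a i v))"

lemma S_eq:
  assumes "\<And>i. i > N \<Longrightarrow> a i v = 0"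
  shows "S m v = (\<Sum>i\<le>N. scaleV (of_int m ^ i / fact i) (a i v))"
  unfolding S_def by (rule Sum_any.expand_superset) (use assms in \<open>auto simp: not_less[symmetric]\<close>)

lemma S_add: "S m (v + w) = S m v + S m w"
proof -
  obtain r s where rs: "\<And>i. i > r \<Longrightarrow> a i v = 0" "\<And>i. i > s \<Longrightarrow> a i w = 0"
    using a_bound[of v] a_bound[of w] by blast
  show ?thesis
    by (simp add: S_eq[of "max r s"] rs a_add scale_right_distrib V.scale_right_distrib sum.distrib)
qed

lemma S_scale: "S m (scaleV c v) = scaleV c (S m v)"
proof -
  obtain r where r: "\<And>i. i > r \<Longrightarrow> a i v = 0"
    using a_bound[of v] by blast
  show ?thesis
    by (simp add: S_eq[of r] r a_scale V.scale_sum_right mult.commute)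
qed

lemma S_diff: "S m (v - w) = S m v - S m w"
  using S_add[of m "v - w" w] by simp

lemma a_bound2: "\<exists>r. (\<forall>i>r. a i v = 0) \<and> (\<forall>j. \<forall>i>r. a i (a j v) = 0)"
proof -
  obtain r where r: "\<And>i. i > r \<Longrightarrow> a i v = 0" using a_bound by blast
  have "\<forall>j. \<exists>s. \<forall>i>s. a i (a j v) = 0" using a_bound by blast
  from choice[OF this] obtain s where s: "\<And>j i. i > s j \<Longrightarrow> a i (a j v) = 0" by blast
  let ?N = "max r (Max (s ` {..r}))"
  have "a i (a j v) = 0" if "i > ?N" for i j
  proof (cases "j > r")
    case False
    then have "s j \<le> Max (s ` {..r})" by (intro Max_ge) auto
    then show ?thesis using that by (intro s) linarith
  qed (simp add: r)
  then show ?thesis using r by (intro exI[of _ ?N]) simp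
qed

lemma exp_conv:
  "(\<Sum>i\<le>n. (x ^ i / fact i) * (y ^ (n - i) / fact (n - i))) = (x + y) ^ n / (fact n :: complex)"
proof -
  have "(x + y) ^ n / fact n = (\<Sum>i\<le>n. of_nat (n choose i) * x ^ i * y ^ (n - i) / fact n)"
    by (simp add: binomial_ring sum_divide_distrib)
  also have "\<dots> = (\<Sum>i\<le>n. (x ^ i / fact i) * (y ^ (n - i) / fact (n - i)))"
    by (rule sum.cong) (auto simp: binomial_fact)
  finally show ?thesis by simp
qed

lemma exp_conv':
  "(\<Sum>i\<le>n. (x ^ i / fact i) * (y ^ (n - i) / fact (n - i)) * of_nat (n - i)) =
     (if n = 0 then 0 else y * ((x + y) ^ (n - 1) / (fact (n - 1) :: complex)))"
proof (cases n)
  case (Suc k)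
  have "(\<Sum>i\<le>k. (x ^ i / fact i) * (y ^ (n - i) / fact (n - i)) * of_nat (n - i)) =
        (\<Sum>i\<le>k. y * ((x ^ i / fact i) * (y ^ (k - i) / fact (k - i))))"
    by (rule sum.cong) (auto simp: Suc Suc_diff_le divide_simps simp del: of_nat_Suc)
  also have "\<dots> = y * ((x + y) ^ k / fact k)"
    by (simp only: sum_distrib_left[symmetric] exp_conv)
  finally show ?thesis by (simp add: Suc)
qed simp

lemma exp_comm:
  "(\<Sum>i\<le>n. (x ^ i / fact i) * (y ^ (n - i) / fact (n - i)) * (of_nat (n - i) - of_nat i)) =
     (if n = 0 then 0 else (y - x) * ((x + y) ^ (n - 1) / (fact (n - 1) :: complex)))"
proof -
  have "(\<Sum>i\<le>n. (x ^ i / fact i) * (y ^ (n - i) / fact (n - i)) * of_nat i) =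
        (\<Sum>i\<le>n. (y ^ i / fact i) * (x ^ (n - i) / fact (n - i)) * of_nat (n - i))"
    by (rule sum.reindex_bij_witness[of _ "\<lambda>i. n - i" "\<lambda>i. n - i"]) (auto simp: mult_ac)
  then show ?thesis
    unfolding right_diff_distrib sum_subtractf exp_conv'
    by (simp add: left_diff_distrib diff_divide_distrib add.commute)
qed

lemma S_comm: "S m (S n v) - S n (S m v) = scaleV (of_int (n - m)) (S (m + n) v)"
proof -
  obtain r where r: "\<And>i. i > r \<Longrightarrow> a i v = 0" "\<And>j i. i > r \<Longrightarrow> a i (a j v) = 0"
    using a_bound2[of v] by blast
  define N where "N = Suc r"
  have N: "\<And>i. i \<ge> N \<Longrightarrow> a i v = 0" "\<And>j i. i \<ge> N \<Longrightarrow> a i (a j v) = 0" "N > 0"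
    using r by (auto simp: N_def)
  define e where "e m i = (of_int m ^ i / fact i :: complex)" for m :: int and i :: nat
  have S1: "S m v = (\<Sum>i\<le>N. scaleV (e m i) (a i v))" for m
    unfolding e_def by (rule S_eq) (simp add: N)
  have aS: "a i (S n v) = (\<Sum>j\<le>N. scaleV (e n j) (a i (a j v)))" for i n
    by (simp add: S1 a_sum a_scale)
  have S2: "S m (S n v) = (\<Sum>i\<le>N. \<Sum>j\<le>N. scaleV (e m i * e n j) (a i (a j v)))" for m n
  proof -
    have "S m (S n v) = (\<Sum>i\<le>N. scaleV (e m i) (a i (S n v)))"
      unfolding e_def by (rule S_eq) (simp add: aS N)
    then show ?thesis by (simp add: aS V.scale_sum_right)
  qed
  have "S n (S m v) = (\<Sum>i\<le>N. \<Sum>j\<le>N. scaleV (e m i * e n j) (a j (a i v)))"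
    unfolding S2 by (subst sum.swap) (simp add: mult.commute)
  then have "S m (S n v) - S n (S m v) =
      (\<Sum>i\<le>N. \<Sum>j\<le>N. scaleV (e m i * e n j) (a i (a j v) - a j (a i v)))"
    by (simp add: S2 sum_subtractf V.scale_right_diff_distrib)
  also have "\<dots> = (\<Sum>i\<le>N. \<Sum>j\<le>N. scaleV (e m i * e n j * (of_nat j - of_nat i)) (a (i + j - 1) v))"
    by (simp add: a_comm)
  also have "\<dots> = (\<Sum>(i,j)\<in>{..N}\<times>{..N}. scaleV (e m i * e n j * (of_nat j - of_nat i)) (a (i + j - 1) v))"
    by (simp add: sum.cartesian_product)
  also have "\<dots> = (\<Sum>(i,j)\<in>{(i,j). i + j \<le> N}. scaleV (e m i * e n j * (of_nat j - of_nat i)) (a (i + j - 1) v))"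
    by (rule sum.mono_neutral_right) (auto intro!: N(1))
  also have "\<dots> = (\<Sum>s\<le>N. \<Sum>i\<le>s. scaleV (e m i * e n (s - i) * (of_nat (s - i) - of_nat i)) (a (s - 1) v))"
    by (subst sum.triangle_reindex_eq) simp
  also have "\<dots> = (\<Sum>s\<le>N. scaleV (if s = 0 then 0 else of_int (n - m) * e (m + n) (s - 1)) (a (s - 1) v))"
    unfolding V.scale_sum_left[symmetric] e_def exp_comm by (intro sum.cong refl) (simp add: add.commute)
  also have "\<dots> = (\<Sum>s\<le>r. scaleV (of_int (n - m) * e (m + n) s) (a s v))"
    unfolding N_def by (subst sum.atMost_Suc_shift) simp
  also have "\<dots> = scaleV (of_int (n - m)) (S (m + n) v)"
    by (subst S_eq[of r]) (simp_all add: r(1) e_def V.scale_sum_right)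
  finally show ?thesis .
qed

lemma a0_S: "a 0 (S n v) - S n (a 0 v) = scaleV (of_int n) (S n v)"
proof -
  have S0: "S 0 v = a 0 v" for v
  proof -
    obtain r where r: "\<And>i. i > r \<Longrightarrow> a i v = 0" using a_bound[of v] by blast
    have "S 0 v = (\<Sum>i\<le>r. scaleV (of_int 0 ^ i / fact i) (a i v))"
      by (rule S_eq) (rule r)
    also have "\<dots> = (\<Sum>i\<le>r. if i = 0 then a 0 v else 0)"
      by (rule sum.cong) (simp_all add: power_0_left)
    finally show ?thesis by simp
  qed
  show ?thesis using S_comm[of 0 n v] unfolding S0 by simp
qed

context
  fixes \<mu> lam \<alpha> :: complex
  assumes \<mu>: "\<mu> \<noteq> 0" and lam: "lam \<noteq> 0"
begin

definition A :: "int \<Rightarrow> 'v \<Rightarrow> 'v" where "A m v = scaleV (\<mu> powi m) (S m v) - a 0 v"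

lemma A_add: "A m (v + w) = A m v + A m w" and A_scale: "A m (scaleV c v) = scaleV c (A m v)"
  by (simp_all add: A_def S_add S_scale a_add a_scale V.scale_right_distrib
      V.scale_right_diff_distrib mult.commute)

lemma A_comm:
  "A m (A n v) - A n (A m v) + scaleV (of_int n) (A n v) - scaleV (of_int m) (A m v) =
     scaleV (of_int (n - m)) (A (m + n) v)"
proof -
  have 1: "a 0 (S k v) = S k (a 0 v) + scaleV (of_int k) (S k v)" for k
    using a0_S[of k v] by (simp add: algebra_simps)
  define P where "P k = \<mu> powi k" for k :: int
  have P: "P (m + n) = P m * P n" by (simp add: P_def power_int_add \<mu>)
  have AP: "A k v = scaleV (P k) (S k v) - a 0 v" for k v
    by (simp add: A_def P_def)
  have AA: "A i (A j v) = scaleV (P i * P j) (S i (S j v)) - scaleV (P i) (S i (a 0 v))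
      - scaleV (P j) (S j (a 0 v)) - scaleV (P j * of_int j) (S j v) + a 0 (a 0 v)" for i j
    by (simp add: AP S_diff S_scale a_diff a_scale 1 V.scale_right_diff_distrib
        V.scale_right_distrib)
  have A': "scaleV c (A k v) = scaleV (P k * c) (S k v) - scaleV c (a 0 v)" for c k
    by (simp add: AP V.scale_right_diff_distrib mult.commute)
  have "A m (A n v) - A n (A m v) + scaleV (of_int n) (A n v) - scaleV (of_int m) (A m v) =
      scaleV (P m * P n) (S m (S n v) - S n (S m v)) -
      (scaleV (of_int n) (a 0 v) - scaleV (of_int m) (a 0 v))"
    unfolding AA A' V.scale_right_diff_distrib mult.commute[of "P n" "P m"] by simp
  also have "\<dots> = scaleV (of_int (n - m)) (A (m + n) v)"
    unfolding A' P S_comm 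
    by (simp add: V.scale_left_diff_distrib V.scale_right_diff_distrib right_diff_distrib)
  finally show ?thesis .
qed

definition sh :: "int \<Rightarrow> complex poly \<Rightarrow> complex poly" where
  "sh m f = smult (lam powi m) (pcompose f [:- of_int m, 1:])"

definition pl :: "int \<Rightarrow> complex poly" where "pl m = [:- of_int m * \<alpha>, 1:]"

lemma sh_add: "sh m (f + g) = sh m f + sh m g" and sh_smult: "sh m (smult c f) = smult c (sh m f)"
  by (simp_all add: sh_def pcompose_add pcompose_smult smult_add_right mult.commute)

lemma sh_sh: "sh m (sh n f) = sh (m + n) f"
  by (simp add: sh_def pcompose_smult power_int_add lam pcompose_assoc[symmetric] pcompose_pCons
      add.commute)

lemma sh_pl: "sh m (pl n * f) = (pl n - [:of_int m:]) * sh m f"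
proof -
  have "pcompose (pl n) [:- of_int m, 1:] = pl n - [:of_int m:]"
    by (simp add: pl_def pcompose_pCons)
  then show ?thesis by (simp add: sh_def pcompose_mult)
qed

abbreviation G where "G \<equiv> M_gen scaleV act \<mu> lam \<alpha>"
abbreviation T (infix "\<otimes>" 70) where "T \<equiv> tensor scaleV"

lemma G_eq: "G m v f = v \<otimes> (pl m * sh m f) + A m v \<otimes> sh m f"
  by (simp add: M_gen_def Let_def pl_def sh_def A_def S_def a_def)

interpretation TS: vector_space "tensor_scale scaleV" by (rule tensor_vector_space)

lemma G_bilinear: "tensor_bilinear scaleV (tensor_scale scaleV) (G m)"
  by unfold_locales
    (simp_all add: G_eq A_add A_scale sh_add sh_smult tensor_add_left tensor_add_right
      tensor_scale_left tensor_scale_right distrib_left TS.scale_right_distrib)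

lemma M_basis_act_add: "M_basis_act scaleV act \<mu> lam \<alpha> b (p + q) =
    M_basis_act scaleV act \<mu> lam \<alpha> b p + M_basis_act scaleV act \<mu> lam \<alpha> b q"
  and M_basis_act_scale: "M_basis_act scaleV act \<mu> lam \<alpha> b (tensor_scale scaleV c p) =
    tensor_scale scaleV c (M_basis_act scaleV act \<mu> lam \<alpha> b p)"
  by (cases b; simp add: tensor_bilinear.tensor_lift_add[OF G_bilinear]
        tensor_bilinear.tensor_lift_scale[OF G_bilinear])+

interpretation TC: complex_space "tensor_scale scaleV" ..

abbreviation act' where "act' \<equiv> M_act scaleV act \<mu> lam \<alpha>"

lemma act'_linear:
  "act' (x + y) p = act' x p + act' y p"
  "act' (vir_scale c x) p = tensor_scale scaleV c (act' x p)"
  "act' x (p + q) = act' x p + act' x q"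
  "act' x (tensor_scale scaleV c p) = tensor_scale scaleV c (act' x p)"
  by (simp_all add: M_act_def TC.vir_extend_add TC.vir_extend_scale M_basis_act_add
      M_basis_act_scale TC.vir_extend_fun_add TC.vir_extend_fun_scale)

lemma act'_zero [simp]: "act' 0 p = 0" "act' x 0 = 0"
  using act'_linear(1)[of 0 0 p] act'_linear(3)[of x 0 0] by simp_all

lemma act'_C [simp]: "act' vir_C p = 0"
  by (simp add: M_act_def vir_C_def)

lemma act'_L: "act' (vir_L m) (v \<otimes> f) = G m v f"
  by (simp add: M_act_def vir_L_def tensor_bilinear.tensor_lift_tensor[OF G_bilinear])

lemma tensor_diff_right: "v \<otimes> (f - g) = v \<otimes> f - v \<otimes> g"
  using tensor_add_right[of v "f - g" g] by simp

lemma tensor_diff_left: "(v - w) \<otimes> f = v \<otimes> f - w \<otimes> f"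
  using tensor_add_left[of "v - w" w f] by simp

lemma act'_bracket_LL:
  "act' (vir_bracket (vir_L m) (vir_L n)) (v \<otimes> f) =
     act' (vir_L m) (act' (vir_L n) (v \<otimes> f)) - act' (vir_L n) (act' (vir_L m) (v \<otimes> f))"
proof -
  define g where "g = sh (m + n) f"
  have GG: "act' (vir_L i) (act' (vir_L j) (v \<otimes> f)) =
      v \<otimes> (pl i * ((pl j - [:of_int i:]) * g)) + A i v \<otimes> ((pl j - [:of_int i:]) * g) +
      (A j v \<otimes> (pl i * g) + A i (A j v) \<otimes> g)" if "i + j = m + n" for i j
    by (simp only: act'_L G_eq act'_linear sh_pl sh_sh that g_def)
  have p1: "pl m * ((pl n - [:of_int m:]) * g) - pl n * ((pl m - [:of_int n:]) * g) =
      smult (of_int (n - m)) (pl (m + n) * g)"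
  proof -
    have "pl m * (pl n - [:of_int m:]) - pl n * (pl m - [:of_int n:]) = smult (of_int (n - m)) (pl (m + n))"
      by (simp add: pl_def algebra_simps)
    then show ?thesis
      by (metis (no_types) left_diff_distrib mult.assoc mult_smult_left)
  qed
  have p2: "(pl j - [:of_int i:]) * g = pl j * g - smult (of_int i) g" for i j
    by (simp add: left_diff_distrib)
  have "act' (vir_L m) (act' (vir_L n) (v \<otimes> f)) - act' (vir_L n) (act' (vir_L m) (v \<otimes> f)) =
      v \<otimes> smult (of_int (n - m)) (pl (m + n) * g) +
      (A m (A n v) - A n (A m v) + scaleV (of_int n) (A n v) - scaleV (of_int m) (A m v)) \<otimes> g"
    unfolding GG[OF refl] GG[OF add.commute] p1[symmetric]
    by (simp add: p2 tensor_diff_right tensor_diff_left tensor_add_left tensor_scale_left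
        tensor_scale_right)
  also have "\<dots> = tensor_scale scaleV (of_int (n - m)) (act' (vir_L (m + n)) (v \<otimes> f))"
    unfolding A_comm by (simp only: tensor_scale_left tensor_scale_right act'_L G_eq g_def
        TS.scale_right_distrib)
  also have "\<dots> = act' (vir_bracket (vir_L m) (vir_L n)) (v \<otimes> f)"
    by (auto simp: vir_bracket_L_L act'_linear simp del: of_int_diff)
  finally show ?thesis by simp
qed

lemma act'_bracket:
  "act' (vir_bracket x y) p = act' x (act' y p) - act' y (act' x p)" (is "?P x y p")
proof -
  have LL: "?P (vir_L m) (vir_L n) p" for m n p
  proof (induction p rule: tensor_induct)
    case (add p q)
    then show ?case by (simp add: act'_linear)
  qed (rule act'_bracket_LL)
  have bb: "?P (Poly_Mapping.single b 1) (Poly_Mapping.single c 1) p" for b c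
    using vir_basis_cases[of b] vir_basis_cases[of c]
    by (elim disjE exE) (simp_all only: LL vir_bracket_C act'_C act'_zero diff_self)
  have left: "?P (Poly_Mapping.single b 1) y p" for b
  proof (induction y rule: vir_basis_induct)
    case (basis c d)
    show ?case
      by (simp only: vir_bracket_scale_right act'_linear bb[of b d] TS.scale_right_diff_distrib)
  qed (simp_all add: vir_bracket_add_right act'_linear)
  show ?thesis
  proof (induction x rule: vir_basis_induct)
    case (basis c d)
    show ?case
      by (simp only: vir_bracket_scale_left act'_linear left[of d] TS.scale_right_diff_distrib)
  qed (simp_all add: vir_bracket_add_left act'_linear)
qed

theorem M_act_L:
  "M_act scaleV act \<mu> lam \<alpha> (vir_L m) (tensor scaleV v f) =
     tensor scaleV v (smult (lam powi m) ([:- of_int m * \<alpha>, 1:] * pcompose f [:- of_int m, 1:])) +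
     tensor scaleV
       (scaleV (\<mu> powi m)
          (Sum_any (\<lambda>i::nat. scaleV (of_int m ^ i / fact i) (act (vir_L (int i - 1)) v)))
        - act (vir_L (-1)) v)
       (smult (lam powi m) (pcompose f [:- of_int m, 1:]))"
  unfolding act'_L M_gen_def Let_def ..

theorem M_act_C: "M_act scaleV act \<mu> lam \<alpha> vir_C p = 0"
  by (rule act'_C)

theorem M_lie_module:
  "lie_module vir_scale vir_bracket UNIV (tensor_scale scaleV) (M_act scaleV act \<mu> lam \<alpha>)"
  by unfold_locales
    (auto simp: act'_linear act'_bracket Vir.lie_subalgebra_def VS.subspace_UNIV)

end

end

end

theory Submission
  imports Defs
begin

text \<open>On a fixed vector, \<open>\<lambda>\<^sup>-\<^sup>m L\<^sub>m\<close> has the form \<open>P(m) + \<mu>\<^sup>m Q(m)\<close> with polynomials \<open>P\<close>, \<open>Q\<close> in \<open>m\<close>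
  whose coefficients are vectors. If \<open>\<mu> \<noteq> 1\<close>, the functions \<open>m\<^sup>i\<close> and \<open>\<mu>\<^sup>m m\<^sup>i\<close> on the integers are
  linearly independent, so a submodule \<open>W\<close> contains all these coefficients. The top coefficient
  of \<open>P\<close> on \<open>w\<close> is, up to a factor \<open>\<plusminus>\<alpha>\<close>, the leading coefficient \<open>v\<close> of \<open>w\<close>; hence \<open>v \<otimes> 1 \<in> W\<close>
  when \<open>\<alpha> \<noteq> 0\<close>. The coefficients of \<open>Q\<close> on \<open>v \<otimes> 1\<close> are the multiples \<open>L\<^sub>i\<^sub>-\<^sub>1 v \<otimes> 1 / i!\<close>, so
  simplicity of \<open>V\<close> gives \<open>V \<otimes> 1 \<subseteq> W\<close>, and \<open>L\<^sub>0 = \<partial>\<close> produces everything else.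

  If \<open>\<mu> = 1\<close>, then \<open>L\<^sub>-\<^sub>1\<close> cancels from the action, and the vectors killed by all \<open>L\<^sub>i\<close> with \<open>i \<ge> r\<close>
  give a proper submodule for large \<open>r\<close>. If \<open>\<alpha> = 0\<close>, the image of \<open>\<partial> - L\<^sub>-\<^sub>1\<close> is one.\<close>

section \<open>Exponential polynomials on the integers and separating functionals\<close>

lemma poly_zero_of_int:
  fixes P :: "complex poly"
  assumes "\<And>m::int. poly P (of_int m) = 0"
  shows "P = 0"
proof (rule ccontr)
  assume "P \<noteq> 0"
  then have "finite {x. poly P x = 0}" by (rule poly_roots_finite)
  moreover have "range (of_int :: int \<Rightarrow> complex) \<subseteq> {x. poly P x = 0}" using assms by auto
  ultimately have "finite (range (of_int :: int \<Rightarrow> complex))" by (rule rev_finite_subset)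
  then show False
    by (simp add: finite_image_iff inj_on_def)
qed

lemma lead_coeff_shift:
  fixes P :: "'a::idom poly"
  shows "coeff (pcompose P [:c, 1:]) (degree P) = lead_coeff P"
  using lead_coeff_comp[of "[:c, 1:]" P] by (simp add: degree_pcompose)

text \<open>Subtracting the relation at m from the one at m + 1 lowers the degree of a nonconstant
  \<open>P\<close>, while \<open>Q\<close> becomes \<open>Q'\<close>, whose coefficient at
  \<open>degree Q\<close> is (\<mu> - 1) times that of \<open>Q\<close>. So \<open>Q' = 0\<close>
  forces \<open>Q = 0\<close>, and then \<open>P = 0\<close>.\<close>

lemma exp_poly_eq_0:
  fixes P Q :: "complex poly"
  assumes "\<mu> \<noteq> 0" "\<mu> \<noteq> 1"
    and "\<And>m::int. poly P (of_int m) + \<mu> powi m * poly Q (of_int m) = 0"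
  shows "P = 0 \<and> Q = 0"
  using assms(3)
proof (induction "degree P" arbitrary: P Q rule: less_induct)
  case less
  have Q0: "Q = 0" if "P = 0"
    using less.prems assms(1) that by (intro poly_zero_of_int) simp
  show ?case
  proof (cases "P = 0")
    case False
    define P' where "P' = pcompose P [:1, 1:] - P"
    define Q' where "Q' = smult \<mu> (pcompose Q [:1, 1:]) - Q"
    have PQ': "poly P' (of_int m) + \<mu> powi m * poly Q' (of_int m) = 0" for m
    proof -
      have "poly P' (of_int m) + \<mu> powi m * poly Q' (of_int m) =
          (poly P (of_int (m + 1)) + \<mu> powi (m + 1) * poly Q (of_int (m + 1))) -
          (poly P (of_int m) + \<mu> powi m * poly Q (of_int m))"
        using assms(1) by (simp add: P'_def Q'_def poly_pcompose power_int_add algebra_simps)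
      then show ?thesis by (simp only: less.prems diff_self)
    qed
    have "Q' = 0"
    proof (cases "degree P = 0")
      case True
      then have "P' = 0" by (auto simp: P'_def elim!: degree_eq_zeroE)
      then show ?thesis using PQ' assms(1) by (intro poly_zero_of_int) simp
    next
      case False
      have "degree P' < degree P"
      proof (rule coeff_0_degree_minus_1[THEN le_less_trans])
        show "coeff P' (degree P) = 0" by (simp add: P'_def lead_coeff_shift)
        show "degree P' \<le> degree P"
          unfolding P'_def by (rule degree_diff_le) (simp_all add: degree_pcompose)
        show "degree P - 1 < degree P" using False by simp
      qed
      then show ?thesis using less.hyps PQ' by blast
    qed
    then have "coeff Q' (degree Q) = 0" by simp
    then have "(\<mu> - 1) * lead_coeff Q = 0"
      by (simp add: Q'_def lead_coeff_shift left_diff_distrib)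
    then have "Q = 0" using assms(2) by simp
    moreover have "P = 0" using less.prems \<open>Q = 0\<close> by (intro poly_zero_of_int) simp
    ultimately show ?thesis by simp
  qed (use Q0 in simp)
qed

text \<open>A basis of \<open>W\<close> stays independent when \<open>x\<close> is added. Such
  functionals turn polynomials in m with vector coefficients into scalar ones, to which
  \<open>exp_poly_eq_0\<close> applies.\<close>

lemma (in vector_space) subspace_separation:
  assumes W: "subspace W" and x: "x \<notin> W"
  obtains \<phi> where "Vector_Spaces.linear scale (*) \<phi>" "\<And>w. w \<in> W \<Longrightarrow> \<phi> w = 0" "\<phi> x \<noteq> 0"
proof -
  interpret P: vector_space_pair scale "(*) :: 'a \<Rightarrow> 'a \<Rightarrow> 'a"
    by unfold_locales (auto simp: algebra_simps)
  obtain B where B: "B \<subseteq> W" "independent B" "W \<subseteq> span B"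
    using maximal_independent_subset[of W] by blast
  have span: "span B = W"
    using B W by (metis span_minimal subset_antisym)
  have ind: "independent (insert x B)"
    using B(2) x span by (intro independent_insertI) simp_all
  obtain \<phi> where \<phi>: "Vector_Spaces.linear scale (*) \<phi>"
    "\<forall>b\<in>insert x B. \<phi> b = (if b = x then 1 else 0)"
    using P.linear_independent_extend[OF ind, of "\<lambda>b. if b = x then 1 else 0"] by blast
  have "\<phi> w = 0" if "w \<in> W" for w
  proof (rule P.linear_eq_0_on_span[OF \<phi>(1)])
    show "w \<in> span B" using that span by simp
    show "\<phi> b = 0" if "b \<in> B" for b using \<phi>(2) that x B(1) by auto
  qed
  then show thesis using \<phi> that by auto
qed

section \<open>The operators \<open>a i\<close> on V and the action on the tensor product\<close>

context category_C_module
begin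

interpretation TS: vector_space "tensor_scale scaleV" by (rule tensor_vector_space)


lemma tensor_monom: "v \<otimes> monom c n = monom (scaleV c v) n"
  by (auto intro!: poly_eqI)

lemma tensor_1: "v \<otimes> 1 = [:v:]"
  using tensor_monom[of v 1 0] by (simp add: monom_0 one_pCons)

lemma tensor_pCons_0: "v \<otimes> pCons 0 f = pCons 0 (v \<otimes> f)"
  by (auto intro!: poly_eqI simp: coeff_pCons split: nat.splits)

lemma act_mem_subspace:
  assumes U: "V.subspace U" and a: "\<And>i. a i v \<in> U" and x: "x \<in> vir_a"
  shows "act x v \<in> U"
proof -
  \<comment> \<open>Membership in \<open>vir_a\<close> is carried along because \<open>act\<close>
    is linear only there.\<close>
  have "y \<in> vir_a \<and> act y v \<in> U" if "y \<in> VS.span {vir_L i | i. i \<ge> -1}" for y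
    using that
  proof (induction rule: VS.span_induct_alt)
    case base
    show ?case using act_scale_left[of "vir_L 0" 0 v] V.subspace_0[OF U]
      using L_in_a[of 0] by (simp add: vir_a_def VS.span_zero)
  next
    case (step c x y)
    then obtain i where i: "x = vir_L i" "i \<ge> -1" by blast
    have x: "x \<in> vir_a" using i L_in_a by simp
    then have cx: "vir_scale c x \<in> vir_a" unfolding vir_a_def by (rule VS.span_scale)
    have "act x v \<in> U" using a[of "nat (i + 1)"] i by (simp add: a_def)
    moreover have "vir_scale c x + y \<in> vir_a"
      using cx step.IH unfolding vir_a_def by (blast intro: VS.span_add)
    ultimately show ?case
      using step.IH x cx
      by (simp add: act_add_left act_scale_left V.subspace_add[OF U] V.subspace_scale[OF U])
  qed
  then show ?thesis using x by (simp add: vir_a_def)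
qed

text \<open>The commutator of \<open>a 0\<close> with \<open>a (i + 1)\<close> is i + 1 times
  \<open>a i\<close>. Hence if all operators beyond some index vanished, vanishing would descend to
  every index and the module would be trivial.\<close>

lemma ex_a_neq_0: "\<exists>i>r. \<exists>v. a i v \<noteq> 0"
proof (rule ccontr)
  assume "\<not> ?thesis"
  then have *: "a i v = 0" if "i > r" for i v using that by auto
  have a0: "a i v = 0" if "\<And>i v. i > r \<Longrightarrow> a i v = 0" for i v r
    using that
  proof (induction r arbitrary: i v)
    case 0
    then show ?case
      using a_comm[of 0 1 v] by (cases "i = 0") simp_all
  next
    case (Suc r)
    have "a (Suc r) v = 0" for v
    proof -
      have "scaleV (of_nat (Suc (Suc r))) (a (Suc r) v) = 0"
        using a_comm[of 0 "Suc (Suc r)" v] Suc.prems by simp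
      then show ?thesis by (simp del: of_nat_Suc)
    qed
    then have "a i v = 0" if "i > r" for i v
      using that Suc.prems by (cases "i = Suc r") simp_all
    then show ?case by (rule Suc.IH)
  qed
  have "a i v = 0" for i v
    by (rule a0[OF *])
  then have "act x v \<in> {0}" if "x \<in> vir_a" for x v
    using that by (intro act_mem_subspace) simp_all
  then show False
    using in_category by (simp add: in_category_C_def trivial_module_def)
qed

text \<open>The term \<open>a 0\<close> is split off because it is the one that cancels from
  \<open>A\<close> when \<mu> = 1.\<close>

lemma S_split: "\<exists>N. S m v = a 0 v + (\<Sum>i<N. scaleV (of_int m ^ Suc i / fact (Suc i)) (a (Suc i) v))"
proof -
  obtain N where N: "\<And>i. i > N \<Longrightarrow> a i v = 0" using a_bound[of v] by blast
  show ?thesis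
    by (rule exI[of _ N]) (subst S_eq[OF N], simp_all add: sum.atMost_shift)
qed

lemma S_0: "S 0 v = a 0 v"
  using S_split[of 0 v] by auto

text \<open>Here \<open>F\<close> is thought of as a polynomial in m with coefficients in the
  polynomials in \<partial>; a functional on the latter may be applied coefficientwise before m is
  given a value.\<close>

lemma poly_map_poly_linear:
  fixes h :: "complex poly \<Rightarrow> complex"
  assumes add: "\<And>f g. h (f + g) = h f + h g" and scale: "\<And>c f. h (smult c f) = c * h f"
  shows "h (poly F [:c:]) = poly (map_poly h F) c"
proof (induction F)
  case 0
  show ?case using scale[of 0 0] by simp
next
  case (pCons f F)
  have "h 0 = 0" using scale[of 0 0] by simp
  then show ?case using pCons by (simp add: add scale map_poly_pCons)
qed

context
  fixes \<mu> lam \<alpha> :: complex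
  assumes \<mu>: "\<mu> \<noteq> 0" and lam: "lam \<noteq> 0"
begin

abbreviation M where "M \<equiv> M_act scaleV act \<mu> lam \<alpha>"

lemma M_add_right: "M x (p + q) = M x p + M x q"
  by (rule act'_linear[OF \<mu> lam])

lemma M_sum: "M x (\<Sum>k\<in>K. p k) = (\<Sum>k\<in>K. M x (p k))"
  by (induction K rule: infinite_finite_induct)
    (simp_all add: M_add_right act'_zero[OF \<mu> lam])

lemma M_decomp: "M x p = (\<Sum>k\<le>degree p. M x (coeff p k \<otimes> monom 1 k))"
  by (subst tensor_decomp[of p]) (rule M_sum)

lemma M_L: "M (vir_L m) (v \<otimes> f) = v \<otimes> (pl \<alpha> m * sh lam m f) + A \<mu> m v \<otimes> sh lam m f"
  by (simp add: act'_L[OF \<mu> lam] G_eq[OF \<mu> lam])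

lemma A_eq: "A \<mu> m v = scaleV (\<mu> powi m) (S m v) - a 0 v"
  by (rule A_def[OF \<mu> lam])

lemma pl_eq: "pl \<alpha> m = [:- of_int m * \<alpha>, 1:]"
  by (rule pl_def[OF \<mu> lam])

lemma sh_eq: "sh lam m f = smult (lam powi m) (pcompose f [:- of_int m, 1:])"
  by (rule sh_def[OF \<mu> lam])

text \<open>At m = 0 the \<open>A\<close> term vanishes, as \<open>S 0\<close> is
  \<open>a 0\<close>, and the shift is the identity.\<close>

lemma M_L_0: "M (vir_L 0) p = pCons 0 p"
proof (induction p rule: tensor_induct)
  case (tensor v f)
  show ?case by (simp add: M_L A_eq pl_eq sh_eq S_0 tensor_pCons_0)
qed (simp add: M_add_right)

lemma M_submoduleI:
  assumes W: "TS.subspace W" and L: "\<And>m p. p \<in> W \<Longrightarrow> M (vir_L m) p \<in> W"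
  shows "submodule UNIV (tensor_scale scaleV) M W"
proof -
  have "M x p \<in> W" if p: "p \<in> W" for x p
  proof (induction x rule: vir_basis_induct)
    case zero
    show ?case using TS.subspace_0[OF W] by (simp add: act'_zero[OF \<mu> lam])
  next
    case (basis c b)
    have "M (Poly_Mapping.single b 1) p \<in> W"
      using vir_basis_cases[of b] L[OF p] TS.subspace_0[OF W] by (auto simp: act'_C[OF \<mu> lam])
    then show ?case
      by (simp add: act'_linear[OF \<mu> lam] TS.subspace_scale[OF W])
  next
    case (add x y)
    then show ?case by (simp add: act'_linear[OF \<mu> lam] TS.subspace_add[OF W])
  qed
  then show ?thesis using W by (simp add: submodule_def)
qed

section \<open>The two non-simple cases\<close>

lemma M_mu_1_not_simple:
  assumes "\<mu> = 1"
  shows "\<not> simple_module UNIV (tensor_scale scaleV) M"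
proof
  assume simple: "simple_module UNIV (tensor_scale scaleV) M"
  obtain v :: 'v where v: "v \<noteq> 0" using ex_a_neq_0[of 0] by blast
  obtain r where r: "\<forall>i>r. a i v = 0" using a_bound by blast
  define U where "U = {u. \<forall>i>r. a i u = 0}"
  have U: "V.subspace U"
    by (rule V.subspaceI) (auto simp: U_def a_add a_scale)
  \<comment> \<open>The commutator of \<open>a i\<close> and \<open>a (Suc j)\<close> is a multiple
    of \<open>a (i + j)\<close>, whose index still exceeds r. The operator \<open>a 0\<close> would
    lower the index, hence the restriction to \<open>Suc j\<close>.\<close>
  have aU: "a (Suc j) u \<in> U" if "u \<in> U" for j u
    unfolding U_def mem_Collect_eq
  proof (intro allI impI)
    fix i assume "i > r"
    then show "a i (a (Suc j) u) = 0"
      using that a_comm[of i "Suc j" u] by (simp add: U_def)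
  qed
  have AU: "A \<mu> m u \<in> U" if u: "u \<in> U" for m u
  proof -
    obtain N where "S m u = a 0 u + (\<Sum>i<N. scaleV (of_int m ^ Suc i / fact (Suc i)) (a (Suc i) u))"
      using S_split by blast
    then have "A \<mu> m u = (\<Sum>i<N. scaleV (of_int m ^ Suc i / fact (Suc i)) (a (Suc i) u))"
      using A_eq[of m u] \<open>\<mu> = 1\<close> by simp
    also have "\<dots> \<in> U"
      by (intro V.subspace_sum[OF U] V.subspace_scale[OF U] aU u)
    finally show ?thesis .
  qed
  define W where "W = {p. \<forall>k. coeff p k \<in> U}"
  have W: "TS.subspace W"
    by (rule TS.subspaceI)
      (auto simp: W_def V.subspace_0[OF U] V.subspace_add[OF U] V.subspace_scale[OF U])
  have tW: "u \<otimes> f \<in> W" if "u \<in> U" for u f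
    using that by (simp add: W_def V.subspace_scale[OF U])
  have "submodule UNIV (tensor_scale scaleV) M W"
  proof (rule M_submoduleI[OF W])
    fix m p assume "p \<in> W"
    then have "coeff p k \<in> U" for k by (simp add: W_def)
    then show "M (vir_L m) p \<in> W"
      by (subst M_decomp) (intro TS.subspace_sum[OF W], simp add: M_L TS.subspace_add[OF W] tW AU)
  qed
  with simple have "W = {0} \<or> W = UNIV" by (simp add: simple_module_def)
  moreover have "[:v:] \<in> W" using r tW[of v 1] by (simp add: U_def tensor_1)
  moreover obtain u where "u \<notin> U" using ex_a_neq_0[of r] by (auto simp: U_def)
  then have "[:u:] \<notin> W" by (auto simp: W_def intro: exI[of _ 0])
  ultimately show False using v by auto
qed

text \<open>Under the isomorphism with a tensor product of \<open>\<Omega>(\<lambda>, \<alpha>)\<close> and \<open>V\<close>, the indeterminate of the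
  first factor becomes \<open>\<partial> - L\<^sub>-\<^sub>1\<close>; for \<open>\<alpha> = 0\<close> it maps the module into a submodule.\<close>

lemma M_alpha_0_not_simple:
  assumes "\<alpha> = 0"
  shows "\<not> simple_module UNIV (tensor_scale scaleV) M"
proof
  assume simple: "simple_module UNIV (tensor_scale scaleV) M"
  obtain v :: 'v where v: "v \<noteq> 0" using ex_a_neq_0[of 0] by blast
  \<comment> \<open>This is \<partial> - \<open>L\<^sub>-\<^sub>1\<close>: \<open>pCons 0\<close>
    multiplies by \<partial>, and \<open>a 0\<close> acts on the coefficients.\<close>
  define \<Phi> where "\<Phi> p = pCons 0 p - map_poly (a 0) p" for p
  have coeff_\<Phi>: "coeff (\<Phi> p) k = (case k of 0 \<Rightarrow> 0 | Suc j \<Rightarrow> coeff p j) - a 0 (coeff p k)" for p k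
    by (simp add: \<Phi>_def coeff_map_poly coeff_pCons)
  have \<Phi>_add: "\<Phi> (p + q) = \<Phi> p + \<Phi> q" and \<Phi>_scale: "\<Phi> (tensor_scale scaleV c p) = tensor_scale scaleV c (\<Phi> p)"
    for p q c
    by (auto intro!: poly_eqI simp: coeff_\<Phi> a_add a_scale V.scale_right_diff_distrib split: nat.splits)
  have \<Phi>_diff: "\<Phi> (p - q) = \<Phi> p - \<Phi> q" for p q
    using \<Phi>_add[of "p - q" q] by simp
  have \<Phi>_tensor: "\<Phi> (u \<otimes> f) = u \<otimes> pCons 0 f - a 0 u \<otimes> f" for u f
    by (auto intro!: poly_eqI simp: coeff_\<Phi> a_scale coeff_pCons split: nat.splits)
  have W: "TS.subspace (range \<Phi>)"
  proof (rule TS.subspaceI)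
    show "0 \<in> range \<Phi>" using \<Phi>_scale[of 0 0] by (metis TS.scale_zero_left rangeI)
    show "x + y \<in> range \<Phi>" if "x \<in> range \<Phi>" "y \<in> range \<Phi>" for x y
      using that by (auto simp flip: \<Phi>_add)
    show "tensor_scale scaleV c x \<in> range \<Phi>" if "x \<in> range \<Phi>" for x c
      using that by (auto simp flip: \<Phi>_scale)
  qed
  have "submodule UNIV (tensor_scale scaleV) M (range \<Phi>)"
  proof (rule M_submoduleI[OF W])
    fix m p assume "p \<in> range \<Phi>"
    then obtain q where q: "p = \<Phi> q" by blast
    \<comment> \<open>Moving \<Phi> to the left past \<open>L\<^sub>m\<close> costs a multiple of
      the shift: for q = u \<otimes> f the preimage found below is \<open>L\<^sub>m\<close> q - m (u
      \<otimes> g), where g is the shifted f.\<close>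
    have "M (vir_L m) (\<Phi> q) \<in> range \<Phi>"
    proof (induction q rule: tensor_induct)
      case (tensor u f)
      define g where "g = sh lam m f"
      have x: "sh lam m (pCons 0 f) = pCons 0 g - smult (of_int m) g"
        by (simp add: sh_eq g_def pcompose_pCons smult_diff_right mult.commute)
      have pCons_0: "pCons 0 (p - smult c q) = pCons 0 p - smult c (pCons 0 q)"
        for p q :: "complex poly" and c by simp
      have Mdiff: "M x (p - q) = M x p - M x q" for x p q
        using M_add_right[of x "p - q" q] by simp
      have "a 0 (A \<mu> m u) - A \<mu> m (a 0 u) =
          scaleV (\<mu> powi m) (a 0 (S m u) - S m (a 0 u))"
        by (simp add: A_eq a_diff a_scale V.scale_right_diff_distrib)
      also have "\<dots> = scaleV (of_int m) (A \<mu> m u + a 0 u)"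
        by (simp add: a0_S A_eq mult.commute)
      finally have DA: "a 0 (A \<mu> m u) = A \<mu> m (a 0 u) + scaleV (of_int m) (A \<mu> m u + a 0 u)"
        by (simp add: algebra_simps)
      have scale_diff: "v \<otimes> (f - smult c g) = v \<otimes> f - tensor_scale scaleV c (v \<otimes> g)" for v f c g
        by (simp add: tensor_diff_right[OF \<mu> lam] tensor_scale_right)
      have pl_mult: "pl \<alpha> m * p = pCons 0 p" for p
        using pl_eq[of m] \<open>\<alpha> = 0\<close> by simp
      have "M (vir_L m) (\<Phi> (u \<otimes> f)) =
          u \<otimes> pCons 0 (pCons 0 g) - tensor_scale scaleV (of_int m) (u \<otimes> pCons 0 g) +
          (A \<mu> m u \<otimes> pCons 0 g - tensor_scale scaleV (of_int m) (A \<mu> m u \<otimes> g)) -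
          (a 0 u \<otimes> pCons 0 g + A \<mu> m (a 0 u) \<otimes> g)"
        by (simp only: \<Phi>_tensor Mdiff M_L x g_def[symmetric] pl_mult pCons_0 scale_diff)
      also have "\<dots> = u \<otimes> pCons 0 (pCons 0 g) - a 0 u \<otimes> pCons 0 g -
          (tensor_scale scaleV (of_int m) (u \<otimes> pCons 0 g) -
           tensor_scale scaleV (of_int m) (a 0 u \<otimes> g)) +
          (A \<mu> m u \<otimes> pCons 0 g - (A \<mu> m (a 0 u) \<otimes> g +
            (tensor_scale scaleV (of_int m) (A \<mu> m u \<otimes> g) +
             tensor_scale scaleV (of_int m) (a 0 u \<otimes> g))))"
        by simp
      also have "\<dots> = \<Phi> (u \<otimes> (pCons 0 g - smult (of_int m) g) + A \<mu> m u \<otimes> g)"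
        by (simp only: scale_diff \<Phi>_add \<Phi>_diff \<Phi>_scale \<Phi>_tensor DA tensor_add_left
            tensor_scale_left TS.scale_right_distrib TS.scale_right_diff_distrib)
      finally have "M (vir_L m) (\<Phi> (u \<otimes> f)) =
          \<Phi> (u \<otimes> (pCons 0 g - smult (of_int m) g) + A \<mu> m u \<otimes> g)" .
      then show ?case by simp
    next
      case (add p q)
      then show ?case by (simp add: \<Phi>_add M_add_right TS.subspace_add[OF W])
    qed
    then show "M (vir_L m) p \<in> range \<Phi>" by (simp add: q)
  qed
  with simple have "range \<Phi> = {0} \<or> range \<Phi> = UNIV" by (simp add: simple_module_def)
  \<comment> \<open>\<Phi> raises the degree of every nonzero element by one, so its image is
    nonzero and contains no nonzero constant.\<close>
  moreover have top: "coeff (\<Phi> p) (Suc (degree p)) = lead_coeff p" for p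
    by (simp add: coeff_\<Phi> coeff_eq_0)
  have "\<Phi> [:v:] \<noteq> 0" using top[of "[:v:]"] v by auto
  moreover have "[:v:] \<noteq> \<Phi> p" for p
  proof
    assume *: "[:v:] = \<Phi> p"
    then have "lead_coeff p = coeff [:v:] (Suc (degree p))" by (simp only: top)
    then have "p = 0" by simp
    then show False using * v by (simp add: \<Phi>_def)
  qed
  ultimately show False by (metis UNIV_I rangeE rangeI singletonD)
qed

section \<open>Simplicity in the remaining case\<close>

text \<open>Up to the factor \<open>lam powi m\<close>, the shift of the k-th power of \<partial> is
  the k-th power of \<partial> - m, a polynomial in m. \<open>Q\<close> collects the terms with the
  factor \<open>\<mu> powi m\<close>, \<open>P\<close> all others. The power k + 1 of m arises only
  from -m \<alpha> times the k-th power of -m.\<close>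

lemma functional_M_L_monom:
  assumes add: "\<And>p q. \<phi> (p + q) = \<phi> p + \<phi> q"
    and scale: "\<And>c p. \<phi> (tensor_scale scaleV c p) = c * \<phi> p"
  shows "\<exists>P Q. (\<forall>m. \<phi> (M (vir_L m) (v \<otimes> monom 1 k)) =
            lam powi m * (poly P (of_int m) + \<mu> powi m * poly Q (of_int m))) \<and>
          degree P \<le> Suc k \<and> coeff P (Suc k) = - \<alpha> * (-1) ^ k * \<phi> [:v:] \<and>
          (k = 0 \<longrightarrow> (\<forall>i. coeff Q i = \<phi> [:a i v:] / fact i))"
proof -
  \<comment> \<open>In \<open>F\<close> and \<open>F'\<close> the outer indeterminate is m and the
    inner one is \<partial>: \<open>F j\<close> is the j-th power of \<partial> - m, and
    \<open>F'\<close> is \<open>F k\<close> times \<partial> - m \<alpha>.\<close>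
  obtain N where N: "\<And>i. i > N \<Longrightarrow> a i v = 0" using a_bound[of v] by blast
  define F :: "nat \<Rightarrow> complex poly poly" where "F j = [:[:0, 1:], [:-1:]:] ^ j" for j
  define F' where "F' = [:[:0, 1:], [:- \<alpha>:]:] * F k"
  define h where "h u f = \<phi> (u \<otimes> f)" for u f
  have diff: "\<phi> (p - q) = \<phi> p - \<phi> q" for p q using add[of "p - q" q] by simp
  have zero: "\<phi> 0 = 0" using add[of 0 0] by simp
  have h_add: "h u (f + g) = h u f + h u g" and h_smult: "h u (smult c f) = c * h u f"
    and h_diff: "h (u - w) f = h u f - h w f" and h_scale: "h (scaleV c u) f = c * h u f"
    and h_plus: "h (u + w) f = h u f + h w f" and h_0: "h 0 f = 0" "h u 0 = 0"
    for u w f g c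
    by (simp_all add: h_def tensor_add_right tensor_add_left tensor_diff_left[OF \<mu> lam]
        tensor_scale_left tensor_scale_right add scale diff zero)
  have h_sum: "h (\<Sum>i\<in>I. u i) f = (\<Sum>i\<in>I. h (u i) f)" for u f and I :: "nat set"
    by (induction I rule: infinite_finite_induct) (simp_all add: h_plus h_0)
  have h_poly: "h u (poly G [:c:]) = poly (map_poly (h u) G) c" for u G c
    by (rule poly_map_poly_linear) (simp_all add: h_add h_smult)
  have F: "sh lam m (monom 1 k) = smult (lam powi m) (poly (F k) [:of_int m:])" for m
  proof -
    have "pcompose (monom 1 k) [:- of_int m, 1:] = poly (F k) [:of_int m :: complex:]" for k
      by (induction k) (simp_all add: F_def pcompose_pCons monom_Suc pcompose_1)
    then show ?thesis by (simp add: sh_eq)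
  qed
  have F': "pl \<alpha> m * sh lam m (monom 1 k) = smult (lam powi m) (poly F' [:of_int m:])" for m
    by (simp add: F F'_def pl_eq mult.commute)
  have coeff_F: "degree (F k) \<le> k" "coeff (F k) k = [:(-1) ^ k:]"
  proof -
    have "degree (F k) = k" by (simp add: F_def degree_power_eq)
    moreover have "lead_coeff (F k) = [:(-1) ^ k:]"
      by (simp add: F_def lead_coeff_power poly_const_pow)
    ultimately show "degree (F k) \<le> k" "coeff (F k) k = [:(-1) ^ k:]" by simp_all
  qed
  have F'_eq: "F' = smult [:0, 1:] (F k) + pCons 0 (smult [:- \<alpha>:] (F k))"
    by (simp add: F'_def)
  have h_A: "h (A \<mu> m v) f = \<mu> powi m * (\<Sum>i\<le>N. of_int m ^ i / fact i * h (a i v) f) - h (a 0 v) f"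
    for m f
    by (simp add: A_eq S_eq[OF N] h_diff h_scale h_sum)
  have h_poly_A: "h (A \<mu> m v) (poly G [:c:]) =
      \<mu> powi m * (\<Sum>i\<le>N. of_int m ^ i / fact i * poly (map_poly (h (a i v)) G) c) -
      poly (map_poly (h (a 0 v)) G) c" for m G c
    unfolding h_A[of m "poly G [:c:]"] unfolding h_poly ..
  define P where "P = map_poly (h v) F' - map_poly (h (a 0 v)) (F k)"
  define Q where "Q = (\<Sum>i\<le>N. monom (1 / fact i) i * map_poly (h (a i v)) (F k))"
  have "\<phi> (M (vir_L m) (v \<otimes> monom 1 k)) =
      lam powi m * (poly P (of_int m) + \<mu> powi m * poly Q (of_int m))" for m
  proof -
    have "\<phi> (M (vir_L m) (v \<otimes> monom 1 k)) =
        h v (pl \<alpha> m * sh lam m (monom 1 k)) + h (A \<mu> m v) (sh lam m (monom 1 k))"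
      by (simp add: M_L add h_def)
    also have "\<dots> = lam powi m * (poly (map_poly (h v) F') (of_int m) +
        (\<mu> powi m * (\<Sum>i\<le>N. of_int m ^ i / fact i * poly (map_poly (h (a i v)) (F k)) (of_int m)) -
         poly (map_poly (h (a 0 v)) (F k)) (of_int m)))"
      unfolding F' unfolding F h_smult h_poly_A unfolding h_poly by (rule distrib_left[symmetric])
    finally show ?thesis
      by (simp add: P_def Q_def poly_sum poly_monom)
  qed
  moreover have "degree P \<le> Suc k"
    unfolding P_def
  proof (intro degree_diff_le degree_le allI impI)
    fix i assume "i > Suc k"
    then show "coeff (map_poly (h v) F') i = 0" "coeff (map_poly (h (a 0 v)) (F k)) i = 0"
      using coeff_F(1) by (cases i; simp add: coeff_map_poly h_0 F'_eq coeff_eq_0)+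
  qed
  moreover have "coeff P (Suc k) = - \<alpha> * (-1) ^ k * \<phi> [:v:]"
  proof -
    have "h v [:c:] = c * \<phi> [:v:]" for c
      using h_smult[of v c 1] by (simp add: h_def tensor_1)
    then show ?thesis using coeff_F
      by (simp add: P_def coeff_map_poly h_0 F'_eq coeff_eq_0)
  qed
  moreover have "coeff Q i = \<phi> [:a i v:] / fact i" if "k = 0" for i
  proof -
    have "map_poly (h u) (F k) = [:\<phi> [:u:]:]" for u
      using that by (simp add: F_def h_def tensor_1 map_poly_1)
    then have "coeff Q i = (\<Sum>j\<le>N. if j = i then \<phi> [:a j v:] / fact j else 0)"
      by (simp add: Q_def coeff_sum smult_monom)
    also have "\<dots> = \<phi> [:a i v:] / fact i"
      using N[of i] by (simp add: zero)
    finally show ?thesis .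
  qed
  ultimately show ?thesis by blast
qed

lemma M_simple:
  assumes "simple_module vir_a scaleV act" and "\<alpha> \<noteq> 0" "\<mu> \<noteq> 1"
  shows "simple_module UNIV (tensor_scale scaleV) M"
  unfolding simple_module_def
proof (intro conjI allI impI)
  obtain v :: 'v where "v \<noteq> 0" using ex_a_neq_0[of 0] by blast
  then have "[:v:] \<noteq> 0" by simp
  then show "(UNIV :: 'v poly set) \<noteq> {0}" by blast
  fix W assume "submodule UNIV (tensor_scale scaleV) M W"
  then have W: "TS.subspace W" and MW: "\<And>x w. w \<in> W \<Longrightarrow> M x w \<in> W"
    by (auto simp: submodule_def)
  \<comment> \<open>Membership in \<open>W\<close> is tested on all functionals that vanish on
    \<open>W\<close>.\<close>
  have sep: "x \<in> W" if "\<And>\<phi>. (\<And>p q. \<phi> (p + q) = \<phi> p + \<phi> q) \<Longrightarrow>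
      (\<And>c p. \<phi> (tensor_scale scaleV c p) = c * \<phi> p) \<Longrightarrow> (\<And>w. w \<in> W \<Longrightarrow> \<phi> w = 0) \<Longrightarrow> \<phi> x = 0" for x
  proof (rule ccontr)
    assume "x \<notin> W"
    then obtain \<phi> where \<phi>: "Vector_Spaces.linear (tensor_scale scaleV) (*) \<phi>"
      "\<And>w. w \<in> W \<Longrightarrow> \<phi> w = 0" "\<phi> x \<noteq> 0"
      using TS.subspace_separation[OF W] by blast
    then show False
      using that[of \<phi>] by (simp add: Vector_Spaces.linear_iff)
  qed
  define U where "U = {v. [:v:] \<in> W}"
  have U: "V.subspace U"
  proof (rule V.subspaceI)
    show "0 \<in> U" using TS.subspace_0[OF W] by (simp add: U_def)
    show "x + y \<in> U" if "x \<in> U" "y \<in> U" for x y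
      using TS.subspace_add[OF W, of "[:x:]" "[:y:]"] that by (simp add: U_def)
    show "scaleV c x \<in> U" if "x \<in> U" for x c
      using TS.subspace_scale[OF W, of "[:x:]" c] that
      by (simp add: U_def tensor_scale_def map_poly_pCons)
  qed
  have lead: "lead_coeff w \<in> U" if w: "w \<in> W" for w
    unfolding U_def mem_Collect_eq
  proof (rule sep)
    fix \<phi> assume \<phi>: "\<And>p q. \<phi> (p + q) = \<phi> p + \<phi> q"
      "\<And>c p. \<phi> (tensor_scale scaleV c p) = c * \<phi> p" "\<And>w. w \<in> W \<Longrightarrow> \<phi> w = 0"
    have \<phi>_0: "\<phi> 0 = 0" using \<phi>(1)[of 0 0] by simp
    have \<phi>_sum: "\<phi> (\<Sum>k\<in>K. p k) = (\<Sum>k\<in>K. \<phi> (p k))" for p and K :: "nat set"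
      by (induction K rule: infinite_finite_induct) (simp_all add: \<phi>(1) \<phi>_0)
    \<comment> \<open>Naming the property allows \<open>P\<close> and \<open>Q\<close> to be chosen
      as functions of k.\<close>
    define R where "R k P Q \<longleftrightarrow> (\<forall>m. \<phi> (M (vir_L m) (coeff w k \<otimes> monom 1 k)) =
            lam powi m * (poly P (of_int m) + \<mu> powi m * poly Q (of_int m))) \<and>
          degree P \<le> Suc k \<and> coeff P (Suc k) = - \<alpha> * (-1) ^ k * \<phi> [:coeff w k:]" for k P Q
    have "\<exists>P Q. R k P Q" for k
      unfolding R_def using functional_M_L_monom[OF \<phi>(1,2), of "coeff w k" k] by blast
    then obtain P Q where PQ: "\<And>k. R k (P k) (Q k)" by metis
    let ?n = "degree w"
    have "poly (\<Sum>k\<le>?n. P k) (of_int m) + \<mu> powi m * poly (\<Sum>k\<le>?n. Q k) (of_int m) = 0" for m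
    proof -
      have "\<phi> (M (vir_L m) w) =
          lam powi m * (\<Sum>k\<le>?n. poly (P k) (of_int m) + \<mu> powi m * poly (Q k) (of_int m))"
        using PQ unfolding R_def by (subst M_decomp) (simp add: \<phi>_sum sum_distrib_left)
      then show ?thesis using \<phi>(3)[OF MW[OF w]] lam
        by (simp add: poly_sum sum.distrib sum_distrib_left)
    qed
    then have "(\<Sum>k\<le>?n. P k) = 0"
      using exp_poly_eq_0[OF \<mu> \<open>\<mu> \<noteq> 1\<close>] by blast
    then have "0 = coeff (\<Sum>k\<le>?n. P k) (Suc ?n)" by simp
    \<comment> \<open>Since \<open>P k\<close> has degree at most k + 1, only the leading term of
      \<open>w\<close> reaches the degree \<open>Suc ?n\<close>.\<close>
    also have "\<dots> = (\<Sum>k\<le>?n. if k = ?n then coeff (P ?n) (Suc ?n) else 0)"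
      unfolding coeff_sum
    proof (intro sum.cong refl)
      fix k assume k: "k \<in> {..?n}"
      have "degree (P k) \<le> Suc k" using PQ by (simp add: R_def)
      then show "coeff (P k) (Suc ?n) = (if k = ?n then coeff (P ?n) (Suc ?n) else 0)"
        using k by (auto intro!: coeff_eq_0)
    qed
    also have "\<dots> = - \<alpha> * (-1) ^ ?n * \<phi> [:lead_coeff w:]" using PQ by (simp add: R_def)
    finally show "\<phi> [:lead_coeff w:] = 0" using \<open>\<alpha> \<noteq> 0\<close> by simp
  qed
  have aU: "a i u \<in> U" if u: "u \<in> U" for i u
    unfolding U_def mem_Collect_eq
  proof (rule sep)
    fix \<phi> assume \<phi>: "\<And>p q. \<phi> (p + q) = \<phi> p + \<phi> q"
      "\<And>c p. \<phi> (tensor_scale scaleV c p) = c * \<phi> p" "\<And>w. w \<in> W \<Longrightarrow> \<phi> w = 0"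
    \<comment> \<open>For k = 0 the shift leaves 1 \<otimes>-factors constant, so each coefficient
      of \<open>Q\<close> isolates a single \<open>a i u\<close>.\<close>
    obtain P Q where PQ: "\<And>m. \<phi> (M (vir_L m) (u \<otimes> monom 1 0)) =
            lam powi m * (poly P (of_int m) + \<mu> powi m * poly Q (of_int m))"
      "\<And>i. coeff Q i = \<phi> [:a i u:] / fact i"
      using functional_M_L_monom[OF \<phi>(1,2), of u 0] by blast
    have "u \<otimes> monom 1 0 \<in> W" using u by (simp add: U_def tensor_1)
    then have "poly P (of_int m) + \<mu> powi m * poly Q (of_int m) = 0" for m
      using \<phi>(3)[OF MW] PQ(1)[of m] lam by simp
    then have "Q = 0" using exp_poly_eq_0[OF \<mu> \<open>\<mu> \<noteq> 1\<close>] by blast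
    then show "\<phi> [:a i u:] = 0" using PQ(2)[of i] by simp
  qed
  show "W = {0} \<or> W = UNIV"
  proof (cases "W = {0}")
    case False
    then obtain w where "w \<in> W" "w \<noteq> 0" using TS.subspace_0[OF W] by blast
    then have "lead_coeff w \<in> U" "lead_coeff w \<noteq> 0" using lead by auto
    moreover have "submodule vir_a scaleV act U"
      using U aU act_mem_subspace by (auto simp: submodule_def)
    ultimately have "U = UNIV" using assms(1) by (auto simp: simple_module_def)
    have "p \<in> W" for p
    proof (induction p)
      case 0
      show ?case by (rule TS.subspace_0[OF W])
    next
      case (pCons c p)
      have "[:c:] \<in> W" using \<open>U = UNIV\<close> by (auto simp: U_def)
      moreover have "pCons 0 p \<in> W" using MW[OF pCons.IH, of "vir_L 0"] by (simp add: M_L_0)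
      ultimately show ?case using TS.subspace_add[OF W, of "[:c:]" "pCons 0 p"] by simp
    qed
    then show ?thesis by auto
  qed simp
qed

end

end

theorem theorem3p7:
  fixes \<mu> lam \<alpha> :: complex
    and scaleV :: "complex \<Rightarrow> 'v::ab_group_add \<Rightarrow> 'v"
    and act :: "vir \<Rightarrow> 'v \<Rightarrow> 'v"
  assumes "\<mu> \<noteq> 0" and "lam \<noteq> 0"
    and "in_category_C scaleV act"
    and "simple_module vir_a scaleV act"
  shows "simple_module UNIV (tensor_scale scaleV) (M_act scaleV act \<mu> lam \<alpha>)
           \<longleftrightarrow> \<alpha> \<noteq> 0 \<and> \<mu> \<noteq> 1"
proof -
  interpret category_C_module scaleV act
    by (rule category_C_module.intro) (fact assms(3))
  show ?thesis (is "?simple \<longleftrightarrow> _")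
  proof
    assume ?simple
    then show "\<alpha> \<noteq> 0 \<and> \<mu> \<noteq> 1"
      using M_mu_1_not_simple[OF assms(1,2), of \<alpha>] M_alpha_0_not_simple[OF assms(1,2), of \<alpha>]
      by auto
  next
    assume "\<alpha> \<noteq> 0 \<and> \<mu> \<noteq> 1"
    then show ?simple
      by (intro M_simple assms(1,2,4)) simp_all
  qed
qed

end
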